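(* Let $k\ge 2$, let $0=r_0<r_1<\dots<r_k$ be integers, $d=\gcd(r_1,\dots,r_k)$, $S=\langle r_1,\dots,r_k\rangle$, let $\Bbbk$ be a field, and let $n\ge r_k^4$ be an integer with $\gcd(n,d)=1$. Let $M_n=\langle n,n+r_1,\dots,n+r_k\rangle$. Then $s(\Bbbk[[M_n]])=s(\Bbbk[[M_{n+\lambda r_k}]])$ for every $\lambda\in\mathbb{N}$. Moreover, if $\operatorname{F}(M_n)=i+\mathbf{m}(i)n-n$ with $i\in\operatorname{Ap}(S,dn)$, then $$s(\Bbbk[[M_n]])=|\{j\in P_n''\mid \mathbf{m}(j)=\mathbf{m}(i)\}|+|\{j\in P_n''\mid \mathbf{m}(j)=\mathbf{m}(i)-1\text{ and } j>i\}|\le|P_n''|.$$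
   Context: $\mathbb{N}$ includes $0$, and $\langle a_1,\dots,a_s\rangle=\{\sum\lambda_i a_i\mid\lambda_i\in\mathbb{N}\}$. For a numerical semigroup $H$ (additive submonoid of $\mathbb{N}$ with finite complement), $\operatorname{F}(H)=\max(\mathbb{Z}\setminus H)$ and $\operatorname{PF}(H)=\{x\in\mathbb{Z}\setminus H\mid x+h\in H\ \forall\, 0\neq h\in H\}$. $s(\Bbbk[[H]])$ denotes the reduced type (in the sense of Huneke–Maitra–Mukundan) of the complete local ring $\Bbbk[[H]]$; by a known theorem of Maitra–Mukundan, which may be taken as the definition here, $s(\Bbbk[[H]])$ is the number of elements of $\operatorname{PF}(H)$ in the interval $[\operatorname{F}(H)-e,\operatorname{F}(H)]$, where $e$ is the smallest nonzero element of $H$. $\operatorname{Ap}(S,dn)=\{s\in S\mid s-dn\notin S\}$. For $i\in S$, $\mathbf{m}(i)$ is the minimum of $\lambda_1+\dots+\lambda_k$ over all expressions $i=\lambda_1r_1+\dots+\lambda_kr_k$ with $\lambda_j\in\mathbb{N}$. $P_n=\{i\in\operatorname{Ap}(S,dn)\mid f\equiv i\bmod n\text{ for some }f\in\operatorname{PF}(M_n)\}$ and $P_n''=\{i\in P_n\mid i\ge dn-r_k\}$. *)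

theory Defs
  imports "HOL-Computational_Algebra.Formal_Power_Series" "HOL-Number_Theory.Cong"
begin

definition gen_submonoid :: "nat set \<Rightarrow> nat set" where
  "gen_submonoid A = {\<Sum>a\<in>A. c a * a | c :: nat \<Rightarrow> nat. True}"

text \<open>The maximum is taken over the integers, so the Frobenius number of \<open>\<nat>\<close> is \<open>-1\<close>.\<close>

definition frobenius :: "nat set \<Rightarrow> int" where
  "frobenius H = (GREATEST x :: int. x \<notin> int ` H)"

definition pseudo_frobenius :: "nat set \<Rightarrow> int set" where
  "pseudo_frobenius H = {x :: int. x \<notin> int ` H \<and> (\<forall>h\<in>H. h \<noteq> 0 \<longrightarrow> x + int h \<in> int ` H)}"

definition multiplicity_sg :: "nat set \<Rightarrow> nat" where
  "multiplicity_sg H = (LEAST h. h \<in> H \<and> h \<noteq> 0)"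

text \<open>The complete local ring \<open>K[[H]]\<close>, as a subset of the power series ring \<open>K[[t]]\<close>.\<close>

definition semigroup_ring :: "nat set \<Rightarrow> 'k::field fps set" where
  "semigroup_ring H = {f. \<forall>m. fps_nth f m \<noteq> 0 \<longrightarrow> m \<in> H}"

definition value_semigroup :: "'k::field fps set \<Rightarrow> nat set" where
  "value_semigroup R = {subdegree f | f. f \<in> R \<and> f \<noteq> 0}"

text \<open>The reduced type, intended only for rings of the form \<open>R = K[[H]]\<close> with \<open>H\<close> a numerical
  semigroup, where \<open>value_semigroup R = H\<close>. For these rings the Maitra--Mukundan description of the
  reduced type of Huneke--Maitra--Mukundan is taken as the definition.\<close>

definition reduced_type :: "'k::field fps set \<Rightarrow> nat" where
  "reduced_type R =
     (let H = value_semigroup R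
      in card (pseudo_frobenius H \<inter> {frobenius H - int (multiplicity_sg H) .. frobenius H}))"

definition apery_set :: "nat set \<Rightarrow> nat \<Rightarrow> nat set" where
  "apery_set S m = {s \<in> S. int s - int m \<notin> int ` S}"

text \<open>In what follows the data \<open>r\<^sub>0 < \<dots> < r\<^sub>k\<close> are the values \<open>r 0, \<dots>, r k\<close> of a function
  \<open>r\<close>; its values beyond \<open>k\<close> are irrelevant.\<close>

definition S_semigroup :: "nat \<Rightarrow> (nat \<Rightarrow> nat) \<Rightarrow> nat set" where
  "S_semigroup k r = gen_submonoid (r ` {1..k})"

definition M_semigroup :: "nat \<Rightarrow> (nat \<Rightarrow> nat) \<Rightarrow> nat \<Rightarrow> nat set" where
  "M_semigroup k r n = gen_submonoid ((\<lambda>j. n + r j) ` {0..k})"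

definition min_length :: "nat \<Rightarrow> (nat \<Rightarrow> nat) \<Rightarrow> nat \<Rightarrow> nat" where
  "min_length k r i =
     (LEAST l. \<exists>c :: nat \<Rightarrow> nat. i = (\<Sum>j=1..k. c j * r j) \<and> l = (\<Sum>j=1..k. c j))"

definition P_set :: "nat \<Rightarrow> (nat \<Rightarrow> nat) \<Rightarrow> nat \<Rightarrow> nat set" where
  "P_set k r n = {i \<in> apery_set (S_semigroup k r) (Gcd (r ` {1..k}) * n).
     \<exists>f \<in> pseudo_frobenius (M_semigroup k r n). [f = int i] (mod int n)}"

definition P''_set :: "nat \<Rightarrow> (nat \<Rightarrow> nat) \<Rightarrow> nat \<Rightarrow> nat set" where
  "P''_set k r n = {i \<in> P_set k r n. int i \<ge> int (Gcd (r ` {1..k}) * n) - int (r k)}"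

end

theory Submission imports Defs begin

text \<open>
  Write \<open>R = r\<^sub>k\<close> and let \<open>\<mu> s\<close> be the least length of a factorization of \<open>s \<in> S\<close>. An element of
  \<open>M\<^sub>n\<close> is a sum of \<open>m\<close> generators \<open>n + r\<^sub>j\<close>, so \<open>M\<^sub>n\<close> consists of the numbers \<open>s + m n\<close> with
  \<open>s \<in> S\<close> and \<open>m \<ge> \<mu> s\<close> (lemma \<open>M_eq\<close>). Everything rests on one regularity of \<open>\<mu>\<close>: a
  pigeonhole argument shows that a shortest factorization contains fewer than \<open>R\<close> atoms other than
  \<open>R\<close>. Hence from \<open>R\<^sup>2\<close> on, adding \<open>R\<close> neither changes membership in \<open>S\<close> nor does anything to
  \<open>\<mu>\<close> but increase it by one (\<open>S_shift_iff\<close>, \<open>\<mu>_shift\<close>); moreover \<open>S\<close> contains every multiple of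
  \<open>d\<close> from \<open>R\<^sup>2\<close> on, and \<open>\<mu> u \<le> \<mu> s\<close> as soon as \<open>u + R\<^sup>2 \<le> s\<close>.

  Since \<open>n\<close> is coprime to \<open>d\<close>, each residue class modulo \<open>n\<close> contains exactly one \<open>u\<close> of the
  Apery set of \<open>S\<close> with respect to \<open>d n\<close>, and the least element of \<open>M\<^sub>n\<close> in that class is
  \<open>w u = u + \<mu> u n\<close> (\<open>M_iff_w_le\<close>). So the pseudo-Frobenius numbers of \<open>M\<^sub>n\<close> are the numbers
  \<open>w j - n\<close> with \<open>j \<in> P\<^sub>n\<close>, and the Frobenius number is the largest \<open>w i - n\<close>.

  Now suppose that \<open>j \<in> P\<^sub>n\<close> gives a pseudo-Frobenius number within \<open>n\<close> of the Frobenius number. If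
  \<open>j\<close> were below \<open>d n - R\<close>, then \<open>j + R\<close> would still lie in the Apery set; either \<open>j\<close> is so small
  that \<open>w j\<close> cannot compete, or \<open>w (j + R) = w j + n + R\<close>, which contradicts \<open>j \<in> P\<^sub>n\<close>
  (\<open>top_if_w_large\<close>). So \<open>j\<close> and the Frobenius index \<open>i\<close> both lie in the interval from \<open>d n - R\<close> to
  \<open>d n + R\<^sup>2\<close>, which is shorter than \<open>n\<close>. There the order of the values \<open>w j\<close> is the lexicographic
  order of the pairs \<open>(\<mu> j, j)\<close>, and \<open>w i - n \<le> w j \<le> w i\<close> leaves just the two cases of the formula.

  In this top part of the Apery set, membership in \<open>P\<^sub>n\<close> depends on nothing but the Apery set and
  on \<open>\<mu>\<close> (\<open>top_P_iff\<close>): a step \<open>j + g\<close> that leaves the Apery set always reaches \<open>M\<^sub>n\<close>, because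
  \<open>j + g - d n\<close> is small and therefore has small \<open>\<mu>\<close>. Replacing \<open>n\<close> by \<open>n + \<lambda> R\<close> moves the top part
  by \<open>d \<lambda> R\<close>, a multiple of \<open>R\<close>, and raises \<open>\<mu>\<close> on it by the constant \<open>d \<lambda>\<close>. Thus the two
  cardinalities, and with them the reduced type, stay the same.
\<close>

section \<open>Factorizations as lists\<close>

text \<open>A coefficient vector and a list of generators are two encodings of a factorization. Lists are
  the convenient one for exchanging some atoms for others.\<close>

lemma sums_of_multiples_eq_list_sums:
  fixes r :: "nat \<Rightarrow> nat"
  assumes "finite J"
  shows "(\<exists>c :: nat \<Rightarrow> nat. s = (\<Sum>j\<in>J. c j * r j) \<and> l = (\<Sum>j\<in>J. c j)) \<longleftrightarrow>
         (\<exists>xs. set xs \<subseteq> r ` J \<and> sum_list xs = s \<and> length xs = l)"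
proof
  assume "\<exists>c :: nat \<Rightarrow> nat. s = (\<Sum>j\<in>J. c j * r j) \<and> l = (\<Sum>j\<in>J. c j)"
  then obtain c where c: "s = (\<Sum>j\<in>J. c j * r j)" "l = (\<Sum>j\<in>J. c j)" by blast
  have "\<exists>xs. set xs \<subseteq> r ` J \<and> sum_list xs = (\<Sum>j\<in>J. c j * r j) \<and> length xs = (\<Sum>j\<in>J. c j)"
    using assms
  proof (induction J)
    case empty
    then show ?case by simp
  next
    case (insert a J)
    then obtain xs where "set xs \<subseteq> r ` J" "sum_list xs = (\<Sum>j\<in>J. c j * r j)"
        "length xs = (\<Sum>j\<in>J. c j)" by blast
    then show ?case using insert.hyps
      by (intro exI[of _ "replicate (c a) (r a) @ xs"]) (auto simp: sum_list_replicate)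
  qed
  then show "\<exists>xs. set xs \<subseteq> r ` J \<and> sum_list xs = s \<and> length xs = l" using c by simp
next
  assume "\<exists>xs. set xs \<subseteq> r ` J \<and> sum_list xs = s \<and> length xs = l"
  then obtain xs where "set xs \<subseteq> r ` J" "sum_list xs = s" "length xs = l" by blast
  then show "\<exists>c :: nat \<Rightarrow> nat. s = (\<Sum>j\<in>J. c j * r j) \<and> l = (\<Sum>j\<in>J. c j)"
  proof (induction xs arbitrary: s l)
    case Nil
    then show ?case by (intro exI[of _ "\<lambda>_. 0"]) simp
  next
    case (Cons x xs)
    obtain c where c: "sum_list xs = (\<Sum>j\<in>J. c j * r j)" "length xs = (\<Sum>j\<in>J. c j)"
      using Cons.IH[OF _ refl refl] Cons.prems(1) by auto
    obtain a where a: "a \<in> J" "x = r a" using Cons.prems(1) by auto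
    have upd: "(\<Sum>j\<in>J. (c(a := Suc (c a))) j * g j) = g a + (\<Sum>j\<in>J. c j * g j)" for g :: "nat \<Rightarrow> nat"
    proof -
      have "(\<Sum>j\<in>J - {a}. (c(a := Suc (c a))) j * g j) = (\<Sum>j\<in>J - {a}. c j * g j)"
        by (rule sum.cong) auto
      then show ?thesis
        using a(1) assms by (simp add: sum.remove[of J a])
    qed
    show ?case
      using c a Cons.prems upd[of r] upd[of "\<lambda>_. 1"]
      by (intro exI[of _ "c(a := Suc (c a))"]) auto
  qed
qed

lemma gen_submonoid_eq_list_sums:
  assumes "finite A"
  shows "gen_submonoid A = {sum_list xs | xs. set xs \<subseteq> A}"
  using sums_of_multiples_eq_list_sums[OF assms, of _ "\<lambda>a. a"]
  unfolding gen_submonoid_def by (auto; metis)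

text \<open>Two of the \<open>R + 1\<close> prefix sums of lengths \<open>0\<close> to \<open>R\<close> agree modulo \<open>R\<close>; the entries between them
  form the sublist.\<close>

lemma exists_sublist_dvd_sum:
  fixes R :: nat
  assumes "R > 0" "length xs \<ge> R"
  shows "\<exists>ys zs ws. xs = ys @ zs @ ws \<and> zs \<noteq> [] \<and> R dvd sum_list zs"
proof -
  have "\<not> inj_on (\<lambda>i. sum_list (take i xs) mod R) {0..R}"
  proof (rule pigeonhole)
    have "card ((\<lambda>i. sum_list (take i xs) mod R) ` {0..R}) \<le> card {..<R}"
      using assms(1) by (intro card_mono) auto
    then show "card ((\<lambda>i. sum_list (take i xs) mod R) ` {0..R}) < card {0..R}" by simp
  qed
  then obtain i j where ij: "i < j" "j \<le> R"
    and eq: "sum_list (take i xs) mod R = sum_list (take j xs) mod R"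
    unfolding inj_on_def by (metis atLeastAtMost_iff linorder_neqE_nat)
  define zs where "zs = drop i (take j xs)"
  have take_j: "take j xs = take i xs @ zs"
    using ij(1) unfolding zs_def by (metis append_take_drop_id less_imp_le min.absorb1 take_take)
  have "xs = take i xs @ zs @ drop j xs"
    using take_j by (metis append.assoc append_take_drop_id)
  moreover have "zs \<noteq> []"
    using ij assms(2) unfolding zs_def by simp
  moreover have "R dvd sum_list zs"
    using mod_eq_dvd_iff_nat[of "sum_list (take i xs)" "sum_list (take j xs)" R] eq take_j by simp
  ultimately show ?thesis by blast
qed

lemma value_semigroup_semigroup_ring: "value_semigroup (semigroup_ring H :: 'k::field fps set) = H"
proof (intro equalityI subsetI)
  fix h assume "h \<in> value_semigroup (semigroup_ring H :: 'k fps set)"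
  then obtain f :: "'k fps" where "f \<in> semigroup_ring H" "f \<noteq> 0" "h = subdegree f"
    unfolding value_semigroup_def by blast
  then show "h \<in> H" unfolding semigroup_ring_def by simp
next
  fix h assume "h \<in> H"
  then have "(fps_X ^ h :: 'k fps) \<in> semigroup_ring H" unfolding semigroup_ring_def by simp
  moreover have "subdegree (fps_X ^ h :: 'k fps) = h" by simp
  ultimately show "h \<in> value_semigroup (semigroup_ring H :: 'k fps set)"
    unfolding value_semigroup_def by (intro CollectI exI[of _ "fps_X ^ h"]) simp
qed

section \<open>Minimal factorizations in \<open>S\<close>\<close>

locale generator_sequence =
  fixes k :: nat and r :: "nat \<Rightarrow> nat"
  assumes k_ge_2: "k \<ge> 2" and r_0: "r 0 = 0" and r_mono: "strict_mono_on {0..k} r"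
begin

abbreviation R :: nat where "R \<equiv> r k"
text \<open>A constant of its own rather than an abbreviation: the simplifier rewrites the interval
  \<open>{1..k}\<close>, after which facts about the set of atoms would no longer match.\<close>

definition G :: "nat set" where "G = r ` {1..k}"
abbreviation d :: nat where "d \<equiv> Gcd G"
abbreviation S :: "nat set" where "S \<equiv> S_semigroup k r"
abbreviation \<mu> :: "nat \<Rightarrow> nat" where "\<mu> \<equiv> min_length k r"

lemma r_less: "i < j \<Longrightarrow> j \<le> k \<Longrightarrow> r i < r j"
  using r_mono by (auto simp: strict_mono_on_def)

lemma R_ge_2: "R \<ge> 2"
proof -
  have "r 0 < r 1" "r 1 < R" using k_ge_2 by (auto intro!: r_less)
  then show ?thesis by simp
qed

lemma finite_G: "finite G"
  unfolding G_def by simp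

lemma R_in_G: "R \<in> G"
  unfolding G_def using k_ge_2 by auto

lemma G_bounds: "x \<in> G \<Longrightarrow> 0 < x \<and> x \<le> R"
  unfolding G_def using r_less[of 0] r_less[of _ k] r_0 by (auto simp: le_less)

lemma d_dvd_R: "d dvd R"
  using R_in_G by (rule Gcd_dvd)

lemma d_pos: "d > 0"
  using d_dvd_R R_ge_2 by (metis dvd_0_left_iff gr0I not_numeral_le_zero)

lemma S_eq: "S = {sum_list xs | xs. set xs \<subseteq> G}"
  unfolding S_semigroup_def G_def[symmetric] by (rule gen_submonoid_eq_list_sums) (rule finite_G)

lemma S_add: "x \<in> S \<Longrightarrow> y \<in> S \<Longrightarrow> x + y \<in> S"
proof -
  assume "x \<in> S" "y \<in> S"
  then obtain xs ys where "set xs \<subseteq> G" "x = sum_list xs" "set ys \<subseteq> G" "y = sum_list ys"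
    unfolding S_eq by blast
  then have "x + y = sum_list (xs @ ys)" "set (xs @ ys) \<subseteq> G" by auto
  then show ?thesis unfolding S_eq by blast
qed

lemma zero_in_S: "0 \<in> S"
  unfolding S_eq by (auto intro: exI[of _ "[]"])

lemma G_subset_S: "x \<in> G \<Longrightarrow> x \<in> S"
  unfolding S_eq by (auto intro: exI[of _ "[x]"])

lemma mult_in_S: "x \<in> S \<Longrightarrow> q * x \<in> S"
  by (induction q) (auto intro: zero_in_S S_add)

lemma d_dvd_S: "s \<in> S \<Longrightarrow> d dvd s"
proof -
  have "d dvd sum_list xs" if "set xs \<subseteq> G" for xs
    using that by (induction xs) (auto intro: dvd_add Gcd_dvd)
  then show "s \<in> S \<Longrightarrow> d dvd s" unfolding S_eq by blast
qed

lemma \<mu>_eq_least: "\<mu> s = (LEAST l. \<exists>xs. set xs \<subseteq> G \<and> sum_list xs = s \<and> length xs = l)"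
  unfolding min_length_def sums_of_multiples_eq_list_sums[OF finite_atLeastAtMost] G_def ..

lemma \<mu>_le: "set xs \<subseteq> G \<Longrightarrow> \<mu> (sum_list xs) \<le> length xs"
  unfolding \<mu>_eq_least by (rule Least_le) blast

lemma shortest_factorization:
  assumes "s \<in> S"
  obtains xs where "set xs \<subseteq> G" "sum_list xs = s" "length xs = \<mu> s"
proof -
  obtain ys where "set ys \<subseteq> G" "sum_list ys = s" using assms unfolding S_eq by blast
  then have "\<exists>l. \<exists>xs. set xs \<subseteq> G \<and> sum_list xs = s \<and> length xs = l" by blast
  from LeastI_ex[OF this] show ?thesis
    using that unfolding \<mu>_eq_least[symmetric] by blast
qed

lemma sum_list_le_R: "set xs \<subseteq> G \<Longrightarrow> sum_list xs \<le> length xs * R"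
  using G_bounds by (induction xs) (auto simp: add_mono)

lemma le_\<mu>_R: "s \<in> S \<Longrightarrow> s \<le> \<mu> s * R"
  by (metis shortest_factorization sum_list_le_R)

text \<open>Among \<open>R\<close> atoms other than \<open>R\<close> some have a sum \<open>q * R\<close>, and since each of them is
  smaller than \<open>R\<close>, replacing them by \<open>q\<close> copies of \<open>R\<close> shortens the factorization.\<close>

lemma shortest_factorization_few_small_atoms:
  assumes xs: "set xs \<subseteq> G" "length xs = \<mu> (sum_list xs)"
  shows "length (filter (\<lambda>x. x \<noteq> R) xs) < R"
proof (rule ccontr)
  let ?small = "filter (\<lambda>x. x \<noteq> R) xs" and ?big = "filter (\<lambda>x. \<not> x \<noteq> R) xs"
  assume "\<not> length ?small < R"
  then obtain ys zs ws where split: "?small = ys @ zs @ ws" and zs: "zs \<noteq> []" "R dvd sum_list zs"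
    using exists_sublist_dvd_sum[of R ?small] R_ge_2 by auto
  then obtain q where q: "sum_list zs = R * q" by blast
  have zs_small: "x < R" if "x \<in> set zs" for x
  proof -
    have "x \<in> set ?small" using split that by simp
    then show ?thesis using G_bounds[of x] xs(1) by auto
  qed
  have "sum_list zs < length zs * R"
    using zs(1) zs_small
  proof (induction zs rule: list_nonempty_induct)
    case (cons x zs)
    then show ?case by (simp add: add_less_mono)
  qed simp
  then have q_less: "q < length zs" using q by (simp add: mult.commute[of R])
  \<comment> \<open>the factorization with \<open>zs\<close> replaced by \<open>q\<close> copies of \<open>R\<close>\<close>
  define vs where "vs = ys @ replicate q R @ ws @ ?big"
  have "set ys \<subseteq> set ?small" "set ws \<subseteq> set ?small" unfolding split by auto
  then have vs_G: "set vs \<subseteq> G" using xs(1) R_in_G unfolding vs_def by auto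
  have "sum_list ?small + sum_list ?big = sum_list xs" by (induction xs) auto
  then have vs_sum: "sum_list vs = sum_list xs"
    unfolding split by (simp add: vs_def sum_list_replicate q mult.commute)
  have "length ?small + length ?big = length xs" by (rule sum_length_filter_compl)
  then have "length vs < length xs" unfolding split using q_less by (simp add: vs_def)
  then show False using \<mu>_le[OF vs_G] vs_sum xs(2) by simp
qed

lemma \<mu>_decomposition:
  assumes "s \<in> S"
  obtains ys c where "set ys \<subseteq> G" "length ys < R" "s = sum_list ys + c * R" "\<mu> s = length ys + c"
proof -
  obtain xs where xs: "set xs \<subseteq> G" "sum_list xs = s" "length xs = \<mu> s"
    using shortest_factorization[OF assms] .
  let ?ys = "filter (\<lambda>x. x \<noteq> R) xs" and ?c = "length (filter (\<lambda>x. \<not> x \<noteq> R) xs)"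
  have "length ?ys < R" using xs by (intro shortest_factorization_few_small_atoms) auto
  moreover have "sum_list xs = sum_list ?ys + ?c * R" by (induction xs) auto
  moreover have "length ?ys + ?c = length xs" by (rule sum_length_filter_compl)
  moreover have "set ?ys \<subseteq> G" using xs(1) by auto
  ultimately show ?thesis using that[of ?ys ?c] xs by simp
qed

lemma \<mu>_R_le:
  assumes "s \<in> S"
  shows "\<mu> s * R < R * R + s"
proof -
  obtain ys c where ys: "length ys < R" "s = sum_list ys + c * R" "\<mu> s = length ys + c"
    using \<mu>_decomposition[OF assms] .
  have "\<mu> s * R = length ys * R + c * R" using ys(3) by (simp add: add_mult_distrib)
  also have "\<dots> < R * R + c * R" using ys(1) R_ge_2 by simp
  also have "\<dots> \<le> R * R + s" using ys(2) by simp
  finally show ?thesis .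
qed

text \<open>Although \<open>\<mu>\<close> is not monotone, it lies between \<open>s / R\<close> and \<open>s / R + R\<close>, so it is monotone across
  gaps of length \<open>R\<^sup>2\<close>.\<close>

lemma \<mu>_le_if_far:
  assumes "u \<in> S" "s \<in> S" "u + R * R \<le> s"
  shows "\<mu> u \<le> \<mu> s"
proof -
  have "\<mu> u * R < R * R + u" using \<mu>_R_le assms(1) .
  also have "\<dots> \<le> s" using assms(3) by simp
  also have "\<dots> \<le> \<mu> s * R" using le_\<mu>_R assms(2) .
  finally show ?thesis by simp
qed

lemma \<mu>_add_le: "s \<in> S \<Longrightarrow> g \<in> G \<Longrightarrow> \<mu> (s + g) \<le> Suc (\<mu> s)"
proof -
  assume "s \<in> S" "g \<in> G"
  then obtain xs where "set xs \<subseteq> G" "sum_list xs = s" "length xs = \<mu> s"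
    using shortest_factorization by blast
  then show ?thesis using \<mu>_le[of "g # xs"] \<open>g \<in> G\<close> by (simp add: add.commute)
qed

text \<open>Fewer than \<open>R\<close> atoms other than \<open>R\<close> sum to less than \<open>R\<^sup>2\<close>, so a shortest factorization of
  \<open>s + R\<close> contains the atom \<open>R\<close>, which can be removed.\<close>

lemma S_minus_R:
  assumes "s + R \<in> S" "s + R \<ge> R * R"
  shows "s \<in> S \<and> \<mu> (s + R) = Suc (\<mu> s)"
proof -
  obtain ys c where ys: "set ys \<subseteq> G" "length ys < R" "s + R = sum_list ys + c * R"
      "\<mu> (s + R) = length ys + c"
    using \<mu>_decomposition[OF assms(1)] .
  have "sum_list ys \<le> length ys * R" by (rule sum_list_le_R) (rule ys)
  also have "\<dots> < R * R" using ys(2) by simp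
  finally have "c \<noteq> 0" using ys(3) assms(2) by (cases c) auto
  then obtain c' where c': "c = Suc c'" by (cases c) auto
  let ?vs = "ys @ replicate c' R"
  have vs: "set ?vs \<subseteq> G" using ys(1) R_in_G by auto
  have sum: "sum_list ?vs = s" using ys(3) c' by (simp add: sum_list_replicate)
  have "s \<in> S" using vs sum unfolding S_eq by blast
  moreover have "\<mu> s \<le> length ys + c'" using \<mu>_le[OF vs] sum by simp
  ultimately show ?thesis using \<mu>_add_le[of s R] R_in_G ys(4) c' by simp
qed

lemma S_shift_iff:
  assumes "x + R \<ge> R * R"
  shows "x + t * R \<in> S \<longleftrightarrow> x \<in> S"
proof (induction t)
  case (Suc t)
  have "(x + t * R) + R \<in> S \<longleftrightarrow> x + t * R \<in> S"
    using S_minus_R[of "x + t * R"] S_add[OF _ G_subset_S[OF R_in_G]] assms by auto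
  then show ?case using Suc by (simp add: add_ac)
qed simp

lemma \<mu>_shift:
  assumes "x \<in> S" "x + R \<ge> R * R"
  shows "\<mu> (x + t * R) = \<mu> x + t"
proof (induction t)
  case (Suc t)
  have "x + t * R + R \<in> S" using S_shift_iff[OF assms(2), of "Suc t"] assms(1) by (simp add: add_ac)
  then have "\<mu> (x + t * R + R) = Suc (\<mu> (x + t * R))"
    using S_minus_R[of "x + t * R"] assms(2) by simp
  then show ?case using Suc by (simp add: add_ac)
qed simp

text \<open>The numbers that enter \<open>S\<close> after adding multiples of \<open>R\<close> form the nonnegative part of a
  subgroup of the integers, since \<open>(R - 1) * x\<close> stands in for \<open>- x\<close>. Its generator divides every
  atom, so \<open>d\<close> belongs to it.\<close>

lemma multiple_of_d_eventually_in_S: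
  assumes "d dvd x"
  shows "\<exists>t. x + t * R \<in> S"
proof -
  define D where "D = {x. \<exists>t. x + t * R \<in> S}"
  have S_D: "x \<in> D" if "x \<in> S" for x using that unfolding D_def by (auto intro: exI[of _ 0])
  have D_add: "x + y \<in> D" if "x \<in> D" "y \<in> D" for x y
  proof -
    obtain t u where "x + t * R \<in> S" "y + u * R \<in> S" using \<open>x \<in> D\<close> \<open>y \<in> D\<close> unfolding D_def by blast
    then have "(x + t * R) + (y + u * R) \<in> S" by (rule S_add)
    then have "(x + y) + (t + u) * R \<in> S" by (simp add: algebra_simps)
    then show ?thesis unfolding D_def by blast
  qed
  have D_mult: "q * x \<in> D" if "x \<in> D" for q x
    using that by (induction q) (auto intro: D_add S_D zero_in_S)
  have D_diff: "y - x \<in> D" if "x \<in> D" "y \<in> D" "x \<le> y" for x y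
  proof -
    have "y + (R - 1) * x \<in> D" using D_add D_mult that by blast
    moreover have "y + (R - 1) * x = (y - x) + x * R"
      using R_ge_2 \<open>x \<le> y\<close> by (simp add: algebra_simps)
    ultimately obtain t where "(y - x) + x * R + t * R \<in> S" unfolding D_def by auto
    then have "(y - x) + (x + t) * R \<in> S" by (simp add: algebra_simps)
    then show ?thesis unfolding D_def by blast
  qed
  define g where "g = (LEAST g. g \<in> D \<and> g > 0)"
  have "\<exists>g. g \<in> D \<and> g > 0" using S_D G_subset_S R_in_G R_ge_2 by (intro exI[of _ R]) auto
  then have g: "g \<in> D" "g > 0" unfolding g_def by (metis (mono_tags, lifting) LeastI_ex)+
  have "g dvd y" if "y \<in> D" for y
  proof -
    have "y - (y div g) * g \<in> D" using D_diff[OF D_mult[OF g(1)] that] by simp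
    then have "y mod g \<in> D" by (simp add: minus_div_mult_eq_mod)
    moreover have "y mod g < g" using g(2) by simp
    ultimately have "y mod g = 0" using not_less_Least[of "y mod g" "\<lambda>g. g \<in> D \<and> g > 0"]
      unfolding g_def by auto
    then show ?thesis by auto
  qed
  then have "g dvd d" using S_D G_subset_S by (intro Gcd_greatest) auto
  then have "g dvd x" using assms by (rule dvd_trans)
  then have "x \<in> D" using D_mult[OF g(1)] by (auto simp: mult.commute[of g])
  then show ?thesis unfolding D_def by blast
qed

text \<open>Going down by \<open>R\<close> from an element provided by the previous lemma stays in \<open>S\<close> until \<open>R\<^sup>2\<close>.\<close>

lemma large_multiple_of_d_in_S:
  assumes "d dvd x" "x \<ge> R * R"
  shows "x \<in> S"
  using multiple_of_d_eventually_in_S[OF assms(1)] S_shift_iff[of x] assms(2) by auto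

abbreviation M :: "nat \<Rightarrow> nat set" where "M \<equiv> M_semigroup k r"
abbreviation Ap :: "nat \<Rightarrow> nat set" where "Ap n \<equiv> apery_set S (d * n)"
abbreviation P :: "nat \<Rightarrow> nat set" where "P \<equiv> P_set k r"
abbreviation P'' :: "nat \<Rightarrow> nat set" where "P'' \<equiv> P''_set k r"

text \<open>For \<open>i\<close> in the Apery set of \<open>S\<close> this will be the Apery element of \<open>M\<^sub>n\<close> in the class of \<open>i\<close>
  modulo \<open>n\<close>.\<close>

definition w :: "nat \<Rightarrow> nat \<Rightarrow> nat" where "w n i = i + \<mu> i * n"

definition top_Ap :: "nat \<Rightarrow> nat set" where
  "top_Ap n = {j \<in> Ap n. d * n \<le> j + R}"

text \<open>The index of the Frobenius number, described by the order of the pairs \<open>(\<mu> j, j)\<close>. In contrast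
  to a description by \<open>w n\<close>, this one is visibly unaffected when \<open>j\<close> and \<open>\<mu> j\<close> are translated.\<close>

definition lex_max :: "nat \<Rightarrow> nat \<Rightarrow> bool" where
  "lex_max n i \<longleftrightarrow> i \<in> top_Ap n \<and> (\<forall>j\<in>top_Ap n. \<mu> j < \<mu> i \<or> \<mu> j = \<mu> i \<and> j \<le> i)"

lemma Ap_iff: "s \<in> Ap n \<longleftrightarrow> s \<in> S \<and> (d * n \<le> s \<longrightarrow> s - d * n \<notin> S)"
proof -
  have "int s - int (d * n) \<in> int ` S \<longleftrightarrow> d * n \<le> s \<and> s - d * n \<in> S"
  proof
    assume "int s - int (d * n) \<in> int ` S"
    then obtain y where "int s - int (d * n) = int y" "y \<in> S" by blast
    moreover from this have "s = y + d * n" by linarith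
    ultimately show "d * n \<le> s \<and> s - d * n \<in> S" by simp
  next
    assume "d * n \<le> s \<and> s - d * n \<in> S"
    then show "int s - int (d * n) \<in> int ` S" by (metis imageI of_nat_diff)
  qed
  then show ?thesis unfolding apery_set_def by blast
qed

lemma P''_eq: "P'' n = P n \<inter> top_Ap n"
proof -
  have "int i \<ge> int (d * n) - int R \<longleftrightarrow> d * n \<le> i + R" for i by linarith
  then show ?thesis unfolding P''_set_def P_set_def top_Ap_def G_def by blast
qed

lemma M_eq_list_sums: "M n = {sum_list xs | xs. set xs \<subseteq> (+) n ` insert 0 G}"
proof -
  have "{0..k} = insert 0 {1..k}" by auto
  then have "(\<lambda>j. n + r j) ` {0..k} = (+) n ` insert 0 G" using r_0 by (auto simp: image_image G_def)
  then show ?thesis unfolding M_semigroup_def by (simp add: gen_submonoid_eq_list_sums finite_G)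
qed

lemma M_add: "x \<in> M n \<Longrightarrow> y \<in> M n \<Longrightarrow> x + y \<in> M n"
proof -
  assume "x \<in> M n" "y \<in> M n"
  then obtain xs ys where "set xs \<subseteq> (+) n ` insert 0 G" "x = sum_list xs"
      "set ys \<subseteq> (+) n ` insert 0 G" "y = sum_list ys"
    unfolding M_eq_list_sums by blast
  then have "x + y = sum_list (xs @ ys)" "set (xs @ ys) \<subseteq> (+) n ` insert 0 G" by auto
  then show ?thesis unfolding M_eq_list_sums by blast
qed

text \<open>The atom \<open>n + r\<^sub>0 = n\<close> pads a factorization of \<open>s\<close> of length \<open>\<mu> s\<close> to any greater length.\<close>

lemma M_eq: "M n = {s + m * n | s m. s \<in> S \<and> \<mu> s \<le> m}"
proof (intro equalityI subsetI)
  fix x assume "x \<in> M n"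
  then obtain xs where "set xs \<subseteq> (+) n ` insert 0 G" "x = sum_list xs"
    unfolding M_eq_list_sums by blast
  then have "\<exists>s m. x = s + m * n \<and> s \<in> S \<and> \<mu> s \<le> m"
  proof (induction xs arbitrary: x)
    case Nil
    then show ?case using \<mu>_le[of "[]"] zero_in_S by (intro exI[of _ 0]) auto
  next
    case (Cons y xs)
    then obtain s m where sm: "sum_list xs = s + m * n" "s \<in> S" "\<mu> s \<le> m" by auto
    obtain g where g: "y = n + g" "g \<in> insert 0 G" using Cons.prems by auto
    have "s + g \<in> S" "\<mu> (s + g) \<le> Suc m"
      using sm g(2) \<mu>_add_le[of s g] S_add[of s g] G_subset_S[of g] by auto
    then show ?case using sm(1) g(1) Cons.prems
      by (intro exI[of _ "s + g"] exI[of _ "Suc m"]) simp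
  qed
  then show "x \<in> {s + m * n | s m. s \<in> S \<and> \<mu> s \<le> m}" by blast
next
  fix x assume "x \<in> {s + m * n | s m. s \<in> S \<and> \<mu> s \<le> m}"
  then obtain s m where x: "x = s + m * n" "s \<in> S" "\<mu> s \<le> m" by blast
  obtain xs where xs: "set xs \<subseteq> G" "sum_list xs = s" "length xs = \<mu> s"
    using shortest_factorization[OF x(2)] .
  let ?ys = "map ((+) n) (xs @ replicate (m - \<mu> s) 0)"
  have "sum_list (map ((+) n) zs) = sum_list zs + length zs * n" for zs
    by (induction zs) auto
  then have "sum_list ?ys = s + (\<mu> s + (m - \<mu> s)) * n"
    using xs by (simp add: sum_list_replicate add_mult_distrib)
  then have "sum_list ?ys = x" using x by simp
  moreover have "set ?ys \<subseteq> (+) n ` insert 0 G" using xs(1) by auto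
  ultimately show "x \<in> M n" unfolding M_eq_list_sums by blast
qed

lemma n_in_M: "n \<in> M n"
  unfolding M_eq_list_sums by (intro CollectI exI[of _ "[n]"]) (simp add: image_insert)

lemma M_nonzeroE:
  assumes "h \<in> M n" "h \<noteq> 0"
  obtains g h' where "g \<in> insert 0 G" "h' \<in> M n" "h = n + g + h'"
proof -
  obtain xs where xs: "set xs \<subseteq> (+) n ` insert 0 G" "h = sum_list xs"
    using assms(1) unfolding M_eq_list_sums by blast
  then obtain y ys where y: "xs = y # ys" using assms(2) by (cases xs) auto
  then obtain g where g: "g \<in> insert 0 G" "y = n + g" using xs(1) by auto
  have "sum_list ys \<in> M n" unfolding M_eq_list_sums using xs(1) y by auto
  then show ?thesis using that g y xs(2) by simp
qed

end

section \<open>The Apery set and the pseudo-Frobenius numbers of \<open>M\<^sub>n\<close>\<close>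

locale large_shift = generator_sequence +
  fixes n :: nat
  assumes n_ge: "n \<ge> r k ^ 4" and n_coprime: "coprime n d"
begin

lemma n_ge_R_squares: "4 * (R * R) \<le> n"
proof -
  have "2 * 2 \<le> R * R" by (intro mult_le_mono R_ge_2)
  then have "4 * (R * R) \<le> (R * R) * (R * R)" by (intro mult_le_mono) auto
  also have "\<dots> = R ^ 4" by (simp add: eval_nat_numeral)
  finally show ?thesis using n_ge by simp
qed

lemma R_le_R_square: "R \<le> R * R"
  by simp

lemma n_pos: "n > 0"
  using n_ge_R_squares R_ge_2 R_le_R_square by linarith

lemma n_le_dn: "n \<le> d * n"
  using d_pos by simp

lemma R_squares_le_dn: "4 * (R * R) \<le> d * n"
  using n_ge_R_squares n_le_dn by (rule order_trans)

lemma dn_in_S: "d * n \<in> S"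
  by (rule large_multiple_of_d_in_S[OF dvd_triv_left]) (use R_squares_le_dn in linarith)

lemma Ap_less: "u \<in> Ap n \<Longrightarrow> u < d * n + R * R"
proof (rule ccontr)
  assume u: "u \<in> Ap n" and "\<not> u < d * n + R * R"
  then have "u - d * n \<in> S"
    by (intro large_multiple_of_d_in_S dvd_diff_nat) (auto simp: Ap_iff d_dvd_S)
  then show False using u \<open>\<not> u < d * n + R * R\<close> by (simp add: Ap_iff)
qed

lemma finite_Ap: "finite (Ap n)"
  using Ap_less by (intro finite_subset[of "Ap n" "{..<d * n + R * R}"]) auto

text \<open>Elements of \<open>S\<close> are multiples of \<open>d\<close>, so being congruent modulo \<open>n\<close> they are congruent modulo
  \<open>d n\<close>. If \<open>s\<close> were smaller than \<open>u\<close>, then \<open>u - d n\<close> would be \<open>s\<close> plus a multiple of \<open>d n \<in> S\<close>.\<close>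

lemma Ap_least_in_class:
  assumes u: "u \<in> Ap n" and s: "s \<in> S" and cong: "[u = s] (mod n)"
  shows "s = u \<or> u + d * n \<le> s"
proof -
  have "[u = s] (mod d)" using u s by (auto simp: cong_def Ap_iff dest!: d_dvd_S)
  then have dn: "[u = s] (mod d * n)"
    using cong n_coprime by (simp add: coprime_cong_mult_nat coprime_commute)
  show ?thesis
  proof (cases "u \<le> s")
    case True
    then have "d * n dvd s - u" using dn by (metis cong_altdef_nat cong_sym)
    then show ?thesis using True by (auto dest!: dvd_imp_le)
  next
    case False
    then have "d * n dvd u - s" using dn by (simp add: cong_altdef_nat)
    then obtain q where q: "u - s = d * n * q" by blast
    then obtain q' where q': "q = Suc q'" using False by (cases q) auto
    have u_eq: "u = (s + q' * (d * n)) + d * n" using q q' False by (simp add: algebra_simps)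
    have "s + q' * (d * n) \<in> S" by (rule S_add[OF s mult_in_S[OF dn_in_S]])
    moreover have "u - d * n = s + q' * (d * n)" "d * n \<le> u" using u_eq by linarith+
    ultimately show ?thesis using u by (simp add: Ap_iff)
  qed
qed

lemma Ap_unique: "u \<in> Ap n \<Longrightarrow> v \<in> Ap n \<Longrightarrow> [u = v] (mod n) \<Longrightarrow> u = v"
  using Ap_least_in_class[of u v] Ap_least_in_class[of v u] n_pos d_pos
  by (auto simp: Ap_iff cong_sym)

text \<open>A large multiple of \<open>d\<close> in the given class lies in \<open>S\<close>; the least element of \<open>S\<close> in the class
  then belongs to the Apery set.\<close>

lemma Ap_exists:
  fixes x :: int
  obtains u where "u \<in> Ap n" "[x = int u] (mod int n)"
proof -
  have "coprime (int d) (int n)" using n_coprime by (simp add: coprime_commute)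
  then obtain y where y: "[int d * y = 1] (mod int n)" using cong_solve_coprime_int by blast
  define z where "z = d * nat ((y * x) mod int n)"
  have "int z = int d * ((y * x) mod int n)" using n_pos unfolding z_def by simp
  moreover have "[int d * ((y * x) mod int n) = int d * (y * x)] (mod int n)"
    by (intro cong_mult) auto
  moreover have "[(int d * y) * x = 1 * x] (mod int n)" using y by (intro cong_mult) auto
  ultimately have z: "[int z = x] (mod int n)" by (metis cong_trans mult.assoc mult_1)
  have "z + d * n \<in> S"
  proof (rule large_multiple_of_d_in_S)
    show "d dvd z + d * n" by (simp add: z_def)
    show "R * R \<le> z + d * n" using R_squares_le_dn by linarith
  qed
  moreover have "[x = int (z + d * n)] (mod int n)"
    using z by (simp add: cong_def)
  ultimately have ex: "\<exists>u. u \<in> S \<and> [x = int u] (mod int n)" by blast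
  define u where "u = (LEAST u. u \<in> S \<and> [x = int u] (mod int n))"
  have u: "u \<in> S" "[x = int u] (mod int n)"
    using LeastI_ex[OF ex] unfolding u_def by blast+
  have "u - d * n \<notin> S" if le: "d * n \<le> u"
  proof
    assume "u - d * n \<in> S"
    moreover have "[x = int (u - d * n)] (mod int n)"
    proof -
      have "int u = int (u - d * n) + int d * int n" using le by (simp add: of_nat_diff)
      then show ?thesis using u(2) by (simp add: cong_def)
    qed
    ultimately have "u \<le> u - d * n"
      unfolding u_def by (metis (no_types, lifting) Least_le)
    then show False using le n_pos n_le_dn by linarith
  qed
  then have "u \<in> Ap n" using u(1) by (simp add: Ap_iff)
  then show ?thesis using u(2) by (rule that)
qed

lemma w_cong: "[w n u = u] (mod n)"
  by (simp add: w_def cong_def)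

lemma w_inj: "inj_on (w n) (Ap n)"
  by (rule inj_onI) (metis Ap_unique cong_sym cong_trans w_cong)

text \<open>Any other \<open>s \<in> S\<close> congruent to \<open>u\<close> is at least \<open>u + d n\<close>, and that distance exceeds \<open>R\<^sup>2\<close>, so
  both \<open>s\<close> and \<open>\<mu> s\<close> are at least as large as for \<open>u\<close>.\<close>

lemma w_le_M:
  assumes "u \<in> Ap n" "x \<in> M n" "[x = u] (mod n)"
  shows "w n u \<le> x"
proof -
  obtain s m where x: "x = s + m * n" "s \<in> S" "\<mu> s \<le> m" using assms(2) unfolding M_eq by blast
  have "[u = s] (mod n)" using assms(3) unfolding x(1) by (simp add: cong_def)
  then have u: "s = u \<or> u + d * n \<le> s" using Ap_least_in_class assms(1) x(2) by blast
  then have "u \<le> s" by auto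
  moreover have "\<mu> u \<le> \<mu> s"
    using u
  proof
    assume "u + d * n \<le> s"
    then have "u + R * R \<le> s" using R_squares_le_dn by linarith
    then show ?thesis using assms(1) x(2) \<mu>_le_if_far by (auto simp: Ap_iff)
  qed simp
  ultimately show ?thesis using x(3) unfolding w_def x(1) by (intro add_mono mult_le_mono) auto
qed

lemma M_iff_w_le:
  fixes x :: int
  assumes "u \<in> Ap n" "[x = int u] (mod int n)"
  shows "x \<in> int ` M n \<longleftrightarrow> int (w n u) \<le> x"
proof
  assume "x \<in> int ` M n"
  then show "int (w n u) \<le> x" using w_le_M[OF assms(1)] assms(2) by (auto simp: cong_int_iff)
next
  assume le: "int (w n u) \<le> x"
  have "[x = int (w n u)] (mod int n)"
    using assms(2) w_cong by (metis cong_int_iff cong_sym cong_trans)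
  then obtain q where q: "x - int (w n u) = int n * q" by (metis cong_iff_dvd_diff dvdE)
  then have "q \<ge> 0" using le n_pos by (metis diff_ge_0_iff_ge of_nat_0_less_iff zero_le_mult_iff not_less)
  then have "x = int (u + (\<mu> u + nat q) * n)" using q by (simp add: w_def algebra_simps)
  moreover have "u + (\<mu> u + nat q) * n \<in> M n" using assms(1) unfolding M_eq by (force simp: Ap_iff)
  ultimately show "x \<in> int ` M n" by blast
qed

lemma M_iff_w_le_nat: "u \<in> Ap n \<Longrightarrow> [x = u] (mod n) \<Longrightarrow> x \<in> M n \<longleftrightarrow> w n u \<le> x"
  using M_iff_w_le[of u "int x"] by (auto simp: cong_int_iff)

lemma multiplicity_M: "multiplicity_sg (M n) = n"
  unfolding multiplicity_sg_def
proof (rule Least_equality)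
  show "n \<in> M n \<and> n \<noteq> 0" using n_in_M n_pos by simp
next
  fix h assume "h \<in> M n \<and> h \<noteq> 0"
  then show "n \<le> h" by (metis M_nonzeroE le_add1 add.assoc)
qed

lemma w_minus_n_gap: "u \<in> Ap n \<Longrightarrow> int (w n u) - int n \<notin> int ` M n"
proof -
  assume u: "u \<in> Ap n"
  have "[int (w n u) - int n = int u] (mod int n)"
    using w_cong[of u] unfolding cong_int_iff[symmetric] by (simp add: cong_def)
  then show ?thesis using M_iff_w_le[OF u] n_pos by simp
qed

lemma gap_le:
  assumes "x \<notin> int ` M n"
  obtains u where "u \<in> Ap n" "[x = int u] (mod int n)" "x \<le> int (w n u) - int n"
proof -
  obtain u where u: "u \<in> Ap n" "[x = int u] (mod int n)" by (rule Ap_exists)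
  have "x < int (w n u)" using M_iff_w_le[OF u] assms by simp
  moreover have "int n dvd int (w n u) - x"
    using u(2) w_cong[of u] unfolding cong_int_iff[symmetric]
    by (metis cong_iff_dvd_diff cong_sym cong_trans)
  ultimately have "int n \<le> int (w n u) - x" by (intro zdvd_imp_le) auto
  then show ?thesis using that u by simp
qed

lemma frobenius_eq:
  assumes "i \<in> Ap n" "\<And>u. u \<in> Ap n \<Longrightarrow> w n u \<le> w n i"
  shows "frobenius (M n) = int (w n i) - int n"
  unfolding frobenius_def
proof (rule Greatest_equality)
  show "int (w n i) - int n \<notin> int ` M n" using w_minus_n_gap assms(1) .
next
  fix y assume "y \<notin> int ` M n"
  then obtain u where "u \<in> Ap n" "y \<le> int (w n u) - int n" by (rule gap_le)
  then show "y \<le> int (w n i) - int n" using assms(2)[of u] by simp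
qed

lemma w_max_exists: obtains i where "i \<in> Ap n" "\<And>u. u \<in> Ap n \<Longrightarrow> w n u \<le> w n i"
proof -
  have ne: "Ap n \<noteq> {}" using Ap_exists[of 0] by blast
  have "Max (w n ` Ap n) \<in> w n ` Ap n" using finite_Ap ne by (intro Max_in) auto
  then obtain i where "i \<in> Ap n" "w n i = Max (w n ` Ap n)" by auto
  then show ?thesis using that finite_Ap by simp
qed

lemma frobenius_iff_w_max:
  assumes "i \<in> Ap n"
  shows "frobenius (M n) = int (w n i) - int n \<longleftrightarrow> (\<forall>u\<in>Ap n. w n u \<le> w n i)"
proof -
  obtain i0 where i0: "i0 \<in> Ap n" "\<And>u. u \<in> Ap n \<Longrightarrow> w n u \<le> w n i0" by (rule w_max_exists) blast
  show ?thesis using frobenius_eq[OF i0] i0(2) frobenius_eq[OF assms] by auto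
qed

text \<open>Every nonzero element of \<open>M\<^sub>n\<close> has a generator \<open>n + g\<close> as a summand, so it suffices to test the
  generators, and \<open>g = 0\<close> is automatic.\<close>

lemma pseudo_frobenius_w_iff:
  assumes "j \<in> Ap n"
  shows "int (w n j) - int n \<in> pseudo_frobenius (M n) \<longleftrightarrow> (\<forall>g\<in>G. w n j + g \<in> M n)"
proof
  assume pf: "int (w n j) - int n \<in> pseudo_frobenius (M n)"
  show "\<forall>g\<in>G. w n j + g \<in> M n"
  proof
    fix g assume g: "g \<in> G"
    have "sum_list [n + g] \<in> M n" using g unfolding M_eq_list_sums
      by (intro CollectI exI[of _ "[n + g]"]) auto
    then have "n + g \<in> M n" by simp
    then have "int (w n j) - int n + int (n + g) \<in> int ` M n"
      using pf n_pos unfolding pseudo_frobenius_def by blast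
    moreover have "int (w n j) - int n + int (n + g) = int (w n j + g)" by simp
    ultimately show "w n j + g \<in> M n" by (metis (no_types, lifting) image_iff of_nat_eq_iff)
  qed
next
  assume step: "\<forall>g\<in>G. w n j + g \<in> M n"
  have "int (w n j) - int n + int h \<in> int ` M n" if h: "h \<in> M n" "h \<noteq> 0" for h
  proof -
    obtain g h' where g: "g \<in> insert 0 G" and h': "h' \<in> M n" "h = n + g + h'"
      using M_nonzeroE h by blast
    have "w n j + g \<in> M n"
      using g step M_iff_w_le_nat[OF assms w_cong] by auto
    then have "w n j + g + h' \<in> M n" using h'(1) by (rule M_add)
    moreover have "int (w n j) - int n + int h = int (w n j + g + h')" using h'(2) by simp
    ultimately show ?thesis by blast
  qed
  then show "int (w n j) - int n \<in> pseudo_frobenius (M n)"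
    using w_minus_n_gap[OF assms] unfolding pseudo_frobenius_def by blast
qed

lemma pseudo_frobenius_is_w:
  assumes "f \<in> pseudo_frobenius (M n)" "u \<in> Ap n" "[f = int u] (mod int n)"
  shows "f = int (w n u) - int n"
proof -
  have "f + int n \<in> int ` M n" using assms(1) n_in_M n_pos unfolding pseudo_frobenius_def by auto
  moreover have "[f + int n = int u] (mod int n)" using assms(3) by (simp add: cong_def)
  ultimately have "int (w n u) \<le> f + int n" using M_iff_w_le[OF assms(2)] by blast
  moreover obtain v where v: "v \<in> Ap n" "[f = int v] (mod int n)" "f \<le> int (w n v) - int n"
    using assms(1) gap_le[of f] unfolding pseudo_frobenius_def by blast
  moreover have "u = v" using Ap_unique[OF assms(2) v(1)] assms(3) v(2)
    by (metis cong_int_iff cong_sym cong_trans)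
  ultimately show ?thesis by simp
qed

lemma P_iff: "j \<in> P n \<longleftrightarrow> j \<in> Ap n \<and> (\<forall>g\<in>G. w n j + g \<in> M n)"
proof -
  have "(\<exists>f\<in>pseudo_frobenius (M n). [f = int j] (mod int n)) \<longleftrightarrow>
      int (w n j) - int n \<in> pseudo_frobenius (M n)" if j: "j \<in> Ap n"
  proof
    show "int (w n j) - int n \<in> pseudo_frobenius (M n)"
      if "\<exists>f\<in>pseudo_frobenius (M n). [f = int j] (mod int n)"
      using that pseudo_frobenius_is_w[OF _ j] by metis
    have "[int (w n j) - int n = int j] (mod int n)"
      using w_cong[of j] unfolding cong_int_iff[symmetric] by (simp add: cong_def)
    then show "\<exists>f\<in>pseudo_frobenius (M n). [f = int j] (mod int n)"
      if "int (w n j) - int n \<in> pseudo_frobenius (M n)"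
      using that by blast
  qed
  then show ?thesis unfolding P_set_def G_def[symmetric] using pseudo_frobenius_w_iff by auto
qed

lemma pseudo_frobenius_eq: "pseudo_frobenius (M n) = (\<lambda>j. int (w n j) - int n) ` P n"
proof (intro equalityI subsetI)
  fix f assume f: "f \<in> pseudo_frobenius (M n)"
  obtain u where u: "u \<in> Ap n" "[f = int u] (mod int n)" by (rule Ap_exists)
  have "f = int (w n u) - int n" using pseudo_frobenius_is_w f u by blast
  moreover have "u \<in> P n" using u f unfolding P_set_def G_def by blast
  ultimately show "f \<in> (\<lambda>j. int (w n j) - int n) ` P n" by blast
next
  fix f assume "f \<in> (\<lambda>j. int (w n j) - int n) ` P n"
  then show "f \<in> pseudo_frobenius (M n)" using P_iff pseudo_frobenius_w_iff by auto
qed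

text \<open>Beyond the Frobenius number there are no gaps.\<close>

lemma w_max_in_P:
  assumes "i \<in> Ap n" "\<And>u. u \<in> Ap n \<Longrightarrow> w n u \<le> w n i"
  shows "i \<in> P n"
proof -
  have "w n i + g \<in> M n" for g
  proof (rule ccontr)
    assume "w n i + g \<notin> M n"
    then have "int (w n i + g) \<notin> int ` M n" by (simp only: inj_image_mem_iff[OF inj_of_nat] not_False_eq_True)
    then obtain u where "u \<in> Ap n" "int (w n i + g) \<le> int (w n u) - int n" by (rule gap_le)
    then show False using assms(2)[of u] n_pos by simp
  qed
  then show ?thesis using assms(1) by (simp add: P_iff)
qed

section \<open>The pseudo-Frobenius numbers near the Frobenius number\<close>

text \<open>The witness \<open>d (n - 1)\<close> is the largest multiple of \<open>d\<close> below \<open>d n\<close>; its factorizations have length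
  at least \<open>d (n - 1) / R\<close>, where \<open>n \<ge> R\<^sup>4\<close> enters.\<close>

lemma Ap_w_large: obtains u where "u \<in> Ap n" "R * R * R * n \<le> w n u"
proof
  let ?u = "d * (n - 1)"
  have less: "?u < d * n" using n_pos d_pos by simp
  have ge: "n - 1 \<le> ?u" using d_pos by simp
  have "R * R \<le> ?u" using ge n_ge_R_squares R_ge_2 R_le_R_square by linarith
  then have "?u \<in> S" by (intro large_multiple_of_d_in_S) auto
  then show "?u \<in> Ap n" using less by (simp add: Ap_iff)
  have "(R * R * R - 1) * R < n - 1"
  proof -
    have "(R * R * R - 1) * R = R * R * R * R - R" by (simp add: diff_mult_distrib)
    moreover have "R * R * R * R \<le> n" using n_ge by (simp add: eval_nat_numeral)
    moreover have "R \<le> R * R * R * R" using R_ge_2 by simp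
    ultimately show ?thesis using R_ge_2 by linarith
  qed
  also have "\<dots> \<le> \<mu> ?u * R" using ge le_\<mu>_R[OF \<open>?u \<in> S\<close>] by linarith
  finally have "R * R * R \<le> \<mu> ?u" by (simp only: mult_less_cancel2) linarith
  then have "R * R * R * n \<le> \<mu> ?u * n" by (rule mult_le_mono1)
  then show "R * R * R * n \<le> w n ?u" unfolding w_def by linarith
qed

text \<open>Below \<open>d n - R\<close> the element \<open>j + R\<close> is again in the Apery set. If \<open>j + R \<ge> R\<^sup>2\<close>, then \<open>\<mu>\<close> grows
  by one and \<open>w j + R < w (j + R)\<close> is a gap of \<open>M\<^sub>n\<close>, against \<open>j \<in> P\<^sub>n\<close>. Otherwise \<open>\<mu> j < 2 R\<close>, so
  \<open>w j + n\<close> is below \<open>(2 R + 1) n\<close> and cannot reach the Apery element of size \<open>R\<^sup>3 n\<close>.\<close>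

lemma top_if_w_large:
  assumes j: "j \<in> P n" and large: "\<And>u. u \<in> Ap n \<Longrightarrow> w n u \<le> w n j + n"
  shows "j \<in> top_Ap n"
proof (rule ccontr)
  assume "j \<notin> top_Ap n"
  moreover have jAp: "j \<in> Ap n" using j by (simp add: P_iff)
  ultimately have less: "j + R < d * n" unfolding top_Ap_def by auto
  have jR: "j + R \<in> S" using jAp S_add G_subset_S R_in_G by (simp add: Ap_iff)
  then have jR_Ap: "j + R \<in> Ap n" using less by (simp add: Ap_iff)
  show False
  proof (cases "R * R \<le> j + R")
    case True
    then have "\<mu> (j + R) = Suc (\<mu> j)" using S_minus_R jR by blast
    then have "w n j + R < w n (j + R)" using n_pos by (simp add: w_def)
    moreover have "[w n j + R = j + R] (mod n)" using w_cong by (intro cong_add) auto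
    ultimately have "w n j + R \<notin> M n" using M_iff_w_le_nat jR_Ap by auto
    then show False using j R_in_G by (auto simp: P_iff)
  next
    case False
    have "\<mu> j * R < R * R + j" using \<mu>_R_le jAp by (simp add: Ap_iff)
    also have "\<dots> < (2 * R) * R" using False by simp
    finally have "\<mu> j < 2 * R" by simp
    then have "Suc (\<mu> j) * n \<le> 2 * R * n" by (intro mult_le_mono1) simp
    moreover have "j < n" using False n_ge_R_squares by linarith
    moreover obtain u where "u \<in> Ap n" "R * R * R * n \<le> w n u" by (rule Ap_w_large)
    moreover from this have "R * R * R * n \<le> w n j + n" using large[of u] by simp
    ultimately have "R * R * R * n < 2 * R * n + n" by (simp add: w_def)
    also have "\<dots> = (2 * R + 1) * n" by (simp add: algebra_simps)
    finally have "R * R * R < 2 * R + 1" by (simp only: mult_less_cancel2)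
    moreover have "4 * R \<le> R * R * R" using mult_le_mono[OF R_ge_2 R_ge_2] by simp
    ultimately show False using R_ge_2 by linarith
  qed
qed

lemma top_large: "j \<in> top_Ap n \<Longrightarrow> 2 * (R * R) + R \<le> j"
  using R_squares_le_dn mult_le_mono1[OF R_ge_2, of R] unfolding top_Ap_def mem_Collect_eq
  by linarith

lemma top_dist_less_n:
  assumes "i \<in> top_Ap n" "j \<in> top_Ap n"
  shows "i < j + n"
proof -
  have "i < d * n + R * R" "d * n \<le> j + R" using assms Ap_less unfolding top_Ap_def by auto
  then show ?thesis using n_ge_R_squares R_le_R_square by linarith
qed

lemma top_w_le_iff:
  assumes "i \<in> top_Ap n" "j \<in> top_Ap n"
  shows "w n j \<le> w n i \<longleftrightarrow> \<mu> j < \<mu> i \<or> \<mu> j = \<mu> i \<and> j \<le> i"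
proof -
  have dist: "i < j + n" "j < i + n" using top_dist_less_n assms by auto
  have less: "w n a < w n b" if "\<mu> a < \<mu> b" "a < b + n" for a b
  proof -
    have "Suc (\<mu> a) * n \<le> \<mu> b * n" using that(1) by (intro mult_le_mono1) simp
    then show ?thesis using that(2) by (simp add: w_def)
  qed
  show ?thesis
    using less[of i j] less[of j i] dist by (cases "\<mu> i" "\<mu> j" rule: linorder_cases) (auto simp: w_def)
qed

text \<open>Inside the Apery set, comparing \<open>w j + g\<close> with \<open>w (j + g)\<close> amounts to comparing \<open>\<mu> j\<close> with
  \<open>\<mu> (j + g)\<close>. Outside it, \<open>v = j + g - d n\<close> is an element of \<open>S\<close> with \<open>v + R\<^sup>2 \<le> j\<close>, hence
  \<open>\<mu> v \<le> \<mu> j\<close>, and \<open>w j + g = v + (d + \<mu> j) n\<close> lies in \<open>M\<^sub>n\<close>.\<close>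

lemma top_P_iff:
  assumes "j \<in> top_Ap n"
  shows "j \<in> P n \<longleftrightarrow> (\<forall>g\<in>G. j + g \<in> Ap n \<longrightarrow> \<mu> (j + g) \<le> \<mu> j)"
proof -
  have jAp: "j \<in> Ap n" using assms unfolding top_Ap_def by simp
  then have jS: "j \<in> S" by (simp add: Ap_iff)
  have "w n j + g \<in> M n \<longleftrightarrow> (j + g \<in> Ap n \<longrightarrow> \<mu> (j + g) \<le> \<mu> j)" if g: "g \<in> G" for g
  proof (cases "j + g \<in> Ap n")
    case True
    have "[w n j + g = j + g] (mod n)" using w_cong by (intro cong_add) auto
    then have "w n j + g \<in> M n \<longleftrightarrow> w n (j + g) \<le> w n j + g" using M_iff_w_le_nat True by blast
    also have "\<dots> \<longleftrightarrow> \<mu> (j + g) \<le> \<mu> j" using n_pos by (simp add: w_def)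
    finally show ?thesis using True by simp
  next
    case False
    have "j + g \<in> S" using S_add[OF jS G_subset_S[OF g]] .
    then have v: "d * n \<le> j + g" "j + g - d * n \<in> S" using False by (auto simp: Ap_iff)
    define v where "v = j + g - d * n"
    have "g \<le> R" using G_bounds g by blast
    then have "v + R * R \<le> j" using Ap_less[OF jAp] top_large[OF assms] v(1) unfolding v_def by linarith
    then have "\<mu> v \<le> d + \<mu> j" using \<mu>_le_if_far[of v j] v(2) jS unfolding v_def by simp
    then have "v + (d + \<mu> j) * n \<in> M n" using v(2) unfolding M_eq v_def by blast
    moreover have "w n j + g = v + (d + \<mu> j) * n" using v(1) by (simp add: v_def w_def algebra_simps)
    ultimately show ?thesis using False by simp
  qed
  then show ?thesis using jAp by (auto simp: P_iff)
qed

text \<open>An index of maximal \<open>w\<close> lies in \<open>P\<^sub>n\<close> and hence in the top part, where the order given by \<open>w\<close> is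
  lexicographic. Conversely a lexicographic maximum is unique, so it is that index.\<close>

lemma frobenius_iff_lex_max:
  assumes "i \<in> Ap n"
  shows "frobenius (M n) = int (w n i) - int n \<longleftrightarrow> lex_max n i"
proof -
  have max_top: "u \<in> top_Ap n" if "u \<in> Ap n" "\<And>v. v \<in> Ap n \<Longrightarrow> w n v \<le> w n u" for u
    using that by (intro top_if_w_large w_max_in_P) (auto intro: trans_le_add1)
  have max_lex: "lex_max n u" if "u \<in> Ap n" "\<And>v. v \<in> Ap n \<Longrightarrow> w n v \<le> w n u" for u
    using that max_top[OF that] top_w_le_iff[of u] unfolding lex_max_def top_Ap_def by blast
  obtain i0 where i0: "i0 \<in> Ap n" "\<And>u. u \<in> Ap n \<Longrightarrow> w n u \<le> w n i0" by (rule w_max_exists) blast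
  have "i = i0" if "lex_max n i"
  proof -
    have "i0 \<in> top_Ap n" "i \<in> top_Ap n" using that max_lex[OF i0] unfolding lex_max_def by auto
    then show ?thesis using that max_lex[OF i0] unfolding lex_max_def
      by (metis nat_less_le order_antisym less_asym)
  qed
  then show ?thesis using max_lex[OF assms] i0 unfolding frobenius_iff_w_max[OF assms] by blast
qed

lemma lex_max_exists: obtains i where "lex_max n i"
proof -
  obtain i where i: "i \<in> Ap n" "\<And>u. u \<in> Ap n \<Longrightarrow> w n u \<le> w n i" by (rule w_max_exists) blast
  then show ?thesis using that frobenius_eq[OF i] frobenius_iff_lex_max[OF i(1)] by blast
qed

text \<open>The indices counted by the reduced type are those \<open>j \<in> P\<^sub>n\<close> with \<open>w i \<le> w j + n\<close>. They lie in the
  top part, where indices differ by less than \<open>n\<close>; so \<open>\<mu> j\<close> cannot fall below \<open>\<mu> i - 1\<close>, and if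
  \<open>\<mu> j = \<mu> i - 1\<close> then \<open>j\<close> has to exceed \<open>i\<close>.\<close>

lemma reduced_type_M:
  assumes i: "lex_max n i"
  shows "reduced_type (semigroup_ring (M n) :: 'k::field fps set) =
    card {j \<in> P'' n. \<mu> j = \<mu> i} + card {j \<in> P'' n. Suc (\<mu> j) = \<mu> i \<and> i < j}"
proof -
  have iT: "i \<in> top_Ap n" and iAp: "i \<in> Ap n" using i unfolding lex_max_def top_Ap_def by auto
  have F: "frobenius (M n) = int (w n i) - int n" using frobenius_iff_lex_max[OF iAp] i by blast
  then have w_max: "w n u \<le> w n i" if "u \<in> Ap n" for u
    using frobenius_iff_w_max[OF iAp] that by blast
  have P_Ap: "P n \<subseteq> Ap n" by (auto simp: P_iff)
  define A where "A = {j \<in> P'' n. \<mu> j = \<mu> i}"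
  define B where "B = {j \<in> P'' n. Suc (\<mu> j) = \<mu> i \<and> i < j}"
  have near_iff: "w n i \<le> w n j + n \<longleftrightarrow> \<mu> j = \<mu> i \<or> Suc (\<mu> j) = \<mu> i \<and> i < j" if j: "j \<in> P'' n" for j
  proof -
    have jT: "j \<in> top_Ap n" using j unfolding P''_eq by simp
    have dist: "i < j + n" "j < i + n" using top_dist_less_n iT jT by auto
    have "w n j \<le> w n i" using w_max j P_Ap unfolding P''_eq by auto
    then consider "\<mu> j = \<mu> i" "j \<le> i" | "\<mu> j < \<mu> i" using top_w_le_iff[OF iT jT] by blast
    then show ?thesis
    proof cases
      case 1
      then show ?thesis using dist by (simp add: w_def)
    next
      case 2
      then obtain e where e: "\<mu> i = Suc (\<mu> j + e)" using less_imp_Suc_add by blast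
      show ?thesis
      proof (cases "e = 0")
        case True
        have "i \<noteq> j" using e by auto
        then show ?thesis using e True by (auto simp: w_def)
      next
        case False
        then have "(\<mu> j + 2) * n \<le> \<mu> i * n" using e by (intro mult_le_mono1) simp
        then have "w n j + n < w n i" using dist by (simp add: w_def add_mult_distrib)
        then show ?thesis using e False by simp
      qed
    qed
  qed
  have "{j \<in> P n. w n i \<le> w n j + n} = {j \<in> P'' n. w n i \<le> w n j + n}"
  proof -
    have "j \<in> top_Ap n" if "j \<in> P n" "w n i \<le> w n j + n" for j
      using top_if_w_large[OF that(1)] that(2) w_max by (meson order_trans)
    then show ?thesis unfolding P''_eq by blast
  qed
  also have "\<dots> = A \<union> B" unfolding A_def B_def using near_iff by blast
  finally have near: "{j \<in> P n. w n i \<le> w n j + n} = A \<union> B" .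
  have "pseudo_frobenius (M n) \<inter> {frobenius (M n) - int n .. frobenius (M n)} =
      (\<lambda>j. int (w n j) - int n) ` {j \<in> P n. w n i \<le> w n j + n}"
    unfolding pseudo_frobenius_eq F using w_max P_Ap by auto
  moreover have "inj_on (\<lambda>j. int (w n j) - int n) {j \<in> P n. w n i \<le> w n j + n}"
    using inj_on_subset[OF w_inj, of "{j \<in> P n. w n i \<le> w n j + n}"] P_Ap by (auto simp: inj_on_def)
  ultimately have "reduced_type (semigroup_ring (M n) :: 'k fps set) = card (A \<union> B)"
    unfolding reduced_type_def value_semigroup_semigroup_ring Let_def multiplicity_M near[symmetric]
    by (simp add: card_image)
  also have "\<dots> = card A + card B"
  proof (rule card_Un_disjoint)
    have "finite (P'' n)" using finite_Ap P_Ap unfolding P''_eq by (meson finite_Int finite_subset)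
    then show "finite A" "finite B" unfolding A_def B_def by auto
    show "A \<inter> B = {}" unfolding A_def B_def by auto
  qed
  finally show ?thesis unfolding A_def B_def .
qed

lemma card_near_le:
  "card {j \<in> P'' n. \<mu> j = \<mu> i} + card {j \<in> P'' n. Suc (\<mu> j) = \<mu> i \<and> i < j} \<le> card (P'' n)"
proof -
  have fin: "finite (P'' n)" unfolding P''_eq top_Ap_def using finite_Ap by simp
  have "card {j \<in> P'' n. \<mu> j = \<mu> i} + card {j \<in> P'' n. Suc (\<mu> j) = \<mu> i \<and> i < j} =
      card ({j \<in> P'' n. \<mu> j = \<mu> i} \<union> {j \<in> P'' n. Suc (\<mu> j) = \<mu> i \<and> i < j})"
    using fin by (intro card_Un_disjoint[symmetric]) auto
  also have "\<dots> \<le> card (P'' n)" using fin by (intro card_mono) auto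
  finally show ?thesis .
qed

end

section \<open>Invariance under the shift by a multiple of \<open>r\<^sub>k\<close>\<close>

context generator_sequence
begin

context
  fixes n l :: nat
  assumes n: "large_shift k r n"
begin

interpretation large_shift k r n by (rule n)

lemma large_shift_shift: "large_shift k r (n + l * R)"
proof
  show "R ^ 4 \<le> n + l * R" using n_ge by simp
  have "[n + l * R = n] (mod d)" using d_dvd_R by (simp add: cong_def mod_add_right_eq[symmetric] dvd_imp_mod_0)
  then show "coprime (n + l * R) d" using n_coprime by (metis cong_imp_coprime cong_sym)
qed

interpretation shifted: large_shift k r "n + l * R" by (rule large_shift_shift)

text \<open>Passing from \<open>n\<close> to \<open>n + l R\<close> moves \<open>d n\<close> by \<open>d l R\<close>. The translation by this number is a multiple
  of \<open>R\<close>, so it respects \<open>S\<close> above \<open>R\<^sup>2\<close> and adds the constant \<open>d l\<close> to \<open>\<mu>\<close> there.\<close>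

abbreviation \<sigma> :: "nat \<Rightarrow> nat" where "\<sigma> \<equiv> \<lambda>x. x + (d * l) * R"

lemma dn_shift: "d * (n + l * R) = \<sigma> (d * n)"
  by (simp add: algebra_simps)

lemma Ap_shift:
  assumes "R * R \<le> x"
  shows "\<sigma> x \<in> Ap (n + l * R) \<longleftrightarrow> x \<in> Ap n"
  unfolding Ap_iff unfolding dn_shift using S_shift_iff[of x "d * l"] assms by simp

lemma top_Ap_shift: "top_Ap (n + l * R) = \<sigma> ` top_Ap n"
proof (intro equalityI subsetI)
  fix y assume y: "y \<in> top_Ap (n + l * R)"
  then have ge: "\<sigma> (d * n) \<le> y + R" unfolding top_Ap_def dn_shift by simp
  define x where "x = y - (d * l) * R"
  have "4 * (R * R) \<le> d * n" by (rule R_squares_le_dn)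
  then have "y = \<sigma> x" "R * R \<le> x" "d * n \<le> x + R"
    using ge R_le_R_square unfolding x_def by linarith+
  then show "y \<in> \<sigma> ` top_Ap n" using y Ap_shift[of x] unfolding top_Ap_def by blast
next
  fix y assume "y \<in> \<sigma> ` top_Ap n"
  then obtain x where x: "x \<in> top_Ap n" "y = \<sigma> x" by blast
  then have "R * R \<le> x" using top_large[of x] by linarith
  then show "y \<in> top_Ap (n + l * R)"
    using x Ap_shift[of x] unfolding top_Ap_def dn_shift by simp
qed

lemma \<mu>_top_shift: "x \<in> top_Ap n \<Longrightarrow> \<mu> (\<sigma> x) = \<mu> x + d * l"
  using top_large[of x] by (intro \<mu>_shift) (auto simp: top_Ap_def Ap_iff)

lemma lex_max_shift:
  assumes "lex_max n i"
  shows "lex_max (n + l * R) (\<sigma> i)"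
  using assms \<mu>_top_shift unfolding lex_max_def top_Ap_shift by auto

lemma P_shift:
  assumes x: "x \<in> top_Ap n"
  shows "\<sigma> x \<in> P (n + l * R) \<longleftrightarrow> x \<in> P n"
proof -
  have "\<sigma> x + g \<in> Ap (n + l * R) \<longleftrightarrow> x + g \<in> Ap n" for g
    using Ap_shift[of "x + g"] top_large[OF x] by (simp add: add_ac)
  moreover have "\<mu> (\<sigma> x + g) = \<mu> (x + g) + d * l" if "x + g \<in> Ap n" for g
    using \<mu>_shift[of "x + g" "d * l"] top_large[OF x] that by (simp add: add_ac Ap_iff)
  moreover have "\<sigma> x \<in> top_Ap (n + l * R)" using x unfolding top_Ap_shift by blast
  ultimately show ?thesis
    using top_P_iff[OF x] shifted.top_P_iff[of "\<sigma> x"] \<mu>_top_shift[OF x] by auto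
qed

lemma P''_shift: "P'' (n + l * R) = \<sigma> ` P'' n"
  using P_shift unfolding P''_eq top_Ap_shift by blast

lemma reduced_type_shift:
  "reduced_type (semigroup_ring (M n) :: 'k::field fps set) =
   reduced_type (semigroup_ring (M (n + l * R)) :: 'k fps set)"
proof -
  obtain i where i: "lex_max n i" by (rule lex_max_exists)
  then have iT: "i \<in> top_Ap n" unfolding lex_max_def by blast
  have \<mu>_P'': "\<mu> (\<sigma> x) = \<mu> x + d * l" if "x \<in> P'' n" for x
    using \<mu>_top_shift that unfolding P''_eq by blast
  have "{j \<in> P'' (n + l * R). \<mu> j = \<mu> (\<sigma> i)} = \<sigma> ` {j \<in> P'' n. \<mu> j = \<mu> i}"
    "{j \<in> P'' (n + l * R). Suc (\<mu> j) = \<mu> (\<sigma> i) \<and> \<sigma> i < j} =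
      \<sigma> ` {j \<in> P'' n. Suc (\<mu> j) = \<mu> i \<and> i < j}"
    unfolding P''_shift \<mu>_top_shift[OF iT] using \<mu>_P'' by auto
  then show ?thesis
    by (simp add: reduced_type_M[OF i] shifted.reduced_type_M[OF lex_max_shift[OF i]] card_image)
qed

end

end

theorem proposition6p3:
  fixes k n d :: nat and r :: "nat \<Rightarrow> nat"
  assumes "k \<ge> 2"
    and "r 0 = 0"
    and "strict_mono_on {0..k} r"
    and "d = Gcd (r ` {1..k})"
    and "n \<ge> r k ^ 4"
    and "gcd n d = 1"
  shows "(\<forall>l::nat. reduced_type (semigroup_ring (M_semigroup k r n) :: 'k::field fps set)
             = reduced_type (semigroup_ring (M_semigroup k r (n + l * r k)) :: 'k fps set))
    \<and> (\<forall>i \<in> apery_set (S_semigroup k r) (d * n).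
          frobenius (M_semigroup k r n) = int i + int (min_length k r i) * int n - int n \<longrightarrow>
            reduced_type (semigroup_ring (M_semigroup k r n) :: 'k fps set)
              = card {j \<in> P''_set k r n. min_length k r j = min_length k r i}
                + card {j \<in> P''_set k r n. int (min_length k r j) = int (min_length k r i) - 1 \<and> j > i}
            \<and> card {j \<in> P''_set k r n. min_length k r j = min_length k r i}
                + card {j \<in> P''_set k r n. int (min_length k r j) = int (min_length k r i) - 1 \<and> j > i}
              \<le> card (P''_set k r n))"
proof -
  interpret generator_sequence k r using assms(1-3) by unfold_locales
  have d: "d = Gcd G" using assms(4) unfolding G_def .
  interpret large_shift k r n
    using assms(5,6) by unfold_locales (auto simp: d coprime_iff_gcd_eq_1)
  have Suc_iff: "int (\<mu> j) = int (\<mu> i) - 1 \<longleftrightarrow> Suc (\<mu> j) = \<mu> i" for i j by linarith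
  show ?thesis
    unfolding Suc_iff
  proof (intro conjI allI ballI impI)
    show "reduced_type (semigroup_ring (M n) :: 'k fps set) =
        reduced_type (semigroup_ring (M (n + l * R)) :: 'k fps set)" for l
      by (rule reduced_type_shift) unfold_locales
  next
    fix i assume i: "i \<in> apery_set S (d * n)"
      and F: "frobenius (M n) = int i + int (\<mu> i) * int n - int n"
    have "lex_max n i" using frobenius_iff_lex_max[of i] i F by (simp add: d w_def)
    then show "reduced_type (semigroup_ring (M n) :: 'k fps set) =
        card {j \<in> P'' n. \<mu> j = \<mu> i} + card {j \<in> P'' n. Suc (\<mu> j) = \<mu> i \<and> i < j}"
      by (rule reduced_type_M)
  qed (rule card_near_le)
qed

end
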